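(* Let $(A_1,\succ_1,\prec_1)$ and $(A_2,\succ_2,\prec_2)$ be two anti-dendriform algebras. Suppose that there are linear maps $l_{\succ_1},r_{\succ_1},l_{\prec_1},r_{\prec_1}:A_1\to\mathrm{End}(A_2)$ and $l_{\succ_2},r_{\succ_2},l_{\prec_2},r_{\prec_2}:A_2\to\mathrm{End}(A_1)$. Define operations on $A_1\oplus A_2$ by $$(x,a)\succ(y,b)=(x\succ_1 y+l_{\succ_2}(a)y+r_{\succ_2}(b)x,\ a\succ_2 b+l_{\succ_1}(x)b+r_{\succ_1}(y)a),$$ $$(x,a)\prec(y,b)=(x\prec_1 y+l_{\prec_2}(a)y+r_{\prec_2}(b)x,\ a\prec_2 b+l_{\prec_1}(x)b+r_{\prec_1}(y)a).$$ Then $(A_1\oplus A_2,\succ,\prec)$ is an anti-dendriform algebra if and only if: (a) $(A_2,l_{\succ_1},r_{\succ_1},l_{\prec_1},r_{\prec_1})$ is a representation of $(A_1,\succ_1,\prec_1)$; (b) $(A_1,l_{\succ_2},r_{\succ_2},l_{\prec_2},r_{\prec_2})$ is a representation of $(A_2,\succ_2,\prec_2)$; (c) for all $x,y,z\in A_1$ and $a,b,c\in A_2$: $$x\succ_1(r_{\succ_2}(c)y)+r_{\succ_2}(l_{\succ_1}(y)c)x=-r_{\succ_2}(c)(x\cdot_1 y)=-x\prec_1(r_{\cdot_2}(c)y)-r_{\prec_2}(l_{\cdot_1}(y)c)x=r_{\prec_2}(c)(x\prec_1 y),$$ $$x\succ_1(l_{\succ_2}(b)z)+r_{\succ_2}(r_{\succ_1}(z)b)x=-(r_{\cdot_2}(b)x)\succ_1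 z-l_{\succ_2}(l_{\cdot_1}(x)b)z=-x\prec_1(l_{\cdot_2}(b)z)-r_{\prec_2}(r_{\cdot_1}(z)b)x=(r_{\prec_2}(b)x)\prec_1 z+l_{\prec_2}(l_{\prec_1}(x)b)z,$$ $$l_{\succ_2}(a)(y\succ_1 z)=-(l_{\cdot_2}(a)y)\succ_1 z-l_{\succ_2}(r_{\cdot_1}(y)a)z=-l_{\prec_2}(a)(y\cdot_1 z)=(l_{\prec_2}(a)y)\prec_1 z+l_{\prec_2}(r_{\prec_1}(y)a)z,$$ $$l_{\succ_1}(x)(b\succ_2 c)=-(l_{\cdot_1}(x)b)\succ_2 c-l_{\succ_1}(r_{\cdot_2}(b)x)c=-l_{\prec_1}(x)(b\cdot_2 c)=(l_{\prec_1}(x)b)\prec_2 c+l_{\prec_1}(r_{\prec_2}(b)x)c,$$ $$a\succ_2(l_{\succ_1}(y)c)+r_{\succ_1}(r_{\succ_2}(c)y)a=-(r_{\cdot_1}(y)a)\succ_2 c-l_{\succ_1}(l_{\cdot_2}(a)y)c=-a\prec_2(l_{\cdot_1}(y)c)-r_{\prec_1}(r_{\cdot_2}(c)y)a=(r_{\prec_1}(y)a)\prec_2 c+l_{\prec_1}(l_{\prec_2}(a)y)c,$$ $$a\succ_2(r_{\succ_1}(z)b)+r_{\succ_1}(l_{\succ_2}(b)z)a=-r_{\succ_1}(z)(a\cdot_2 b)=-a\prec_2(r_{\cdot_1}(z)b)-r_{\prec_1}(l_{\cdot_2}(b)z)a=r_{\prec_1}(z)(a\prec_2 b),$$ $$r_{\prec_2}(c)(x\succ_1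 y)=x\succ_1(r_{\prec_2}(c)y)+r_{\succ_2}(l_{\prec_1}(y)c)x,$$ $$(r_{\succ_2}(b)x)\prec_1 z+l_{\prec_2}(l_{\succ_1}(x)b)z=x\succ_1(l_{\prec_2}(b)z)+r_{\succ_2}(r_{\prec_1}(z)b)x,$$ $$(l_{\succ_2}(a)y)\prec_1 z+l_{\prec_2}(r_{\succ_1}(y)a)z=l_{\succ_2}(a)(y\prec_1 z),$$ $$(l_{\succ_1}(x)b)\prec_2 c+l_{\prec_1}(r_{\succ_2}(b)x)c=l_{\succ_1}(x)(b\prec_2 c),$$ $$(r_{\succ_1}(y)a)\prec_2 c+l_{\prec_1}(l_{\succ_2}(a)y)c=a\succ_2(l_{\prec_1}(y)c)+r_{\succ_1}(r_{\prec_2}(c)y)a,$$ $$r_{\prec_1}(z)(a\succ_2 b)=a\succ_2(r_{\prec_1}(z)b)+r_{\succ_1}(l_{\prec_2}(b)z)a,$$ where, for $j=1,2$, $\cdot_j=\succ_j+\prec_j$, $l_{\cdot_j}=l_{\succ_j}+l_{\prec_j}$ and $r_{\cdot_j}=r_{\succ_j}+r_{\prec_j}$.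
   Context: All vector spaces and algebras are over a field $k$, and all algebras are finite-dimensional. An anti-dendriform algebra $(A,\succ,\prec)$ is a vector space with two bilinear maps $\succ,\prec:A\times A\to A$ such that, writing $x\cdot y=x\succ y+x\prec y$, for all $x,y,z$: $x\succ(y\succ z)=-(x\cdot y)\succ z=-x\prec(y\cdot z)=(x\prec y)\prec z$ and $(x\succ y)\prec z=x\succ(y\prec z)$. A representation of $(A,\succ,\prec)$ is $(V,l_{\succ},r_{\succ},l_{\prec},r_{\prec})$ with $V$ a vector space and linear maps $l_{\succ},r_{\succ},l_{\prec},r_{\prec}:A\to\mathrm{End}(V)$ such that, with $l_{\cdot}=l_{\succ}+l_{\prec}$, $r_{\cdot}=r_{\succ}+r_{\prec}$, for all $x,y\in A$: $l_{\succ}(x)l_{\succ}(y)=-l_{\succ}(x\cdot y)=-l_{\prec}(x)l_{\cdot}(y)=l_{\prec}(x\prec y)$; $r_{\succ}(x\succ y)=-r_{\succ}(y)r_{\cdot}(x)=-r_{\prec}(x\cdot y)=r_{\prec}(y)r_{\prec}(x)$; $l_{\succ}(x)r_{\succ}(y)=-r_{\succ}(y)l_{\cdot}(x)=-l_{\prec}(x)r_{\cdot}(y)=r_{\prec}(y)l_{\prec}(x)$; $l_{\prec}(x\succ y)=l_{\succ}(x)l_{\prec}(y)$; $r_{\prec}(y)r_{\succ}(x)=r_{\succ}(x\prec y)$; $r_{\prec}(y)l_{\succ}(x)=l_{\succ}(x)r_{\prec}(y)$. *)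

theory Defs
  imports "HOL-Analysis.Product_Vector" "HOL-Library.Function_Algebras"
begin

text \<open>
  Vector spaces over a field have the whole type as carrier and are given by their scalar
  multiplication. Sums and negatives of maps are pointwise, as in Function_Algebras. The total
  product is written out as \<open>x \<succ> y + x \<prec> y\<close>; the corresponding left and right actions are
  \<open>ls + lp\<close> and \<open>rs + rp\<close>, where \<open>s\<close> stands for \<open>\<succ>\<close> and \<open>p\<close> for \<open>\<prec>\<close>.
\<close>

definition bilinear_map ::
  "('k::field \<Rightarrow> 'u::ab_group_add \<Rightarrow> 'u) \<Rightarrow> ('k \<Rightarrow> 'v::ab_group_add \<Rightarrow> 'v) \<Rightarrow>
   ('k \<Rightarrow> 'w::ab_group_add \<Rightarrow> 'w) \<Rightarrow> ('u \<Rightarrow> 'v \<Rightarrow> 'w) \<Rightarrow> bool"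
  where "bilinear_map sU sV sW f \<longleftrightarrow>
    (\<forall>x. Vector_Spaces.linear sV sW (f x)) \<and> (\<forall>y. Vector_Spaces.linear sU sW (\<lambda>x. f x y))"

text \<open>
  Linear maps from \<open>U\<close> to \<open>End(V)\<close>: the values are endomorphisms of \<open>V\<close>, and the map is linear into
  the space of all functions on \<open>V\<close> with pointwise operations, of which \<open>End(V)\<close> is a subspace.
\<close>

definition linear_into_End ::
  "('k::field \<Rightarrow> 'u::ab_group_add \<Rightarrow> 'u) \<Rightarrow> ('k \<Rightarrow> 'v::ab_group_add \<Rightarrow> 'v) \<Rightarrow>
   ('u \<Rightarrow> 'v \<Rightarrow> 'v) \<Rightarrow> bool"
  where "linear_into_End sU sV l \<longleftrightarrow>
    (\<forall>x. Vector_Spaces.linear sV sV (l x)) \<and> Vector_Spaces.linear sU (\<lambda>c g v. sV c (g v)) l"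

locale anti_dendriform_algebra = vector_space scale
  for scale :: "'k::field \<Rightarrow> 'a::ab_group_add \<Rightarrow> 'a" +
  fixes succ :: "'a \<Rightarrow> 'a \<Rightarrow> 'a" (infixl "\<succ>" 70)
    and prec :: "'a \<Rightarrow> 'a \<Rightarrow> 'a" (infixl "\<prec>" 70)
  assumes finite_dim: "\<exists>Basis. finite_dimensional_vector_space scale Basis"
    and bilinear_succ: "bilinear_map scale scale scale succ"
    and bilinear_prec: "bilinear_map scale scale scale prec"
    and succ_succ: "x \<succ> (y \<succ> z) = - ((x \<succ> y + x \<prec> y) \<succ> z)"
    and succ_dot: "- ((x \<succ> y + x \<prec> y) \<succ> z) = - (x \<prec> (y \<succ> z + y \<prec> z))"
    and prec_dot: "- (x \<prec> (y \<succ> z + y \<prec> z)) = (x \<prec> y) \<prec> z"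
    and succ_prec: "(x \<succ> y) \<prec> z = x \<succ> (y \<prec> z)"

locale anti_dendriform_representation =
  A: anti_dendriform_algebra scaleA succ prec + V: vector_space scaleV
  for scaleA :: "'k::field \<Rightarrow> 'a::ab_group_add \<Rightarrow> 'a"
    and succ :: "'a \<Rightarrow> 'a \<Rightarrow> 'a" (infixl "\<succ>" 70)
    and prec :: "'a \<Rightarrow> 'a \<Rightarrow> 'a" (infixl "\<prec>" 70)
    and scaleV :: "'k \<Rightarrow> 'v::ab_group_add \<Rightarrow> 'v" +
  fixes ls rs lp rp :: "'a \<Rightarrow> 'v \<Rightarrow> 'v"
  assumes linear_ls: "linear_into_End scaleA scaleV ls"
    and linear_rs: "linear_into_End scaleA scaleV rs"
    and linear_lp: "linear_into_End scaleA scaleV lp"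
    and linear_rp: "linear_into_End scaleA scaleV rp"
    and ll1: "ls x \<circ> ls y = - ls (x \<succ> y + x \<prec> y)"
    and ll2: "- ls (x \<succ> y + x \<prec> y) = - (lp x \<circ> (ls + lp) y)"
    and ll3: "- (lp x \<circ> (ls + lp) y) = lp (x \<prec> y)"
    and rr1: "rs (x \<succ> y) = - (rs y \<circ> (rs + rp) x)"
    and rr2: "- (rs y \<circ> (rs + rp) x) = - rp (x \<succ> y + x \<prec> y)"
    and rr3: "- rp (x \<succ> y + x \<prec> y) = rp y \<circ> rp x"
    and lr1: "ls x \<circ> rs y = - (rs y \<circ> (ls + lp) x)"
    and lr2: "- (rs y \<circ> (ls + lp) x) = - (lp x \<circ> (rs + rp) y)"
    and lr3: "- (lp x \<circ> (rs + rp) y) = rp y \<circ> lp x"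
    and lp_succ: "lp (x \<succ> y) = ls x \<circ> lp y"
    and rp_rs: "rp y \<circ> rs x = rs (x \<prec> y)"
    and rp_ls: "rp y \<circ> ls x = ls x \<circ> rp y"

text \<open>
  Here \<open>l1\<close>, \<open>r1\<close> are the actions of the first algebra on the second,
  \<open>l2\<close>, \<open>r2\<close> those of the second on the first.
\<close>

definition bowtie_op ::
  "('a::plus \<Rightarrow> 'a \<Rightarrow> 'a) \<Rightarrow> ('b::plus \<Rightarrow> 'b \<Rightarrow> 'b) \<Rightarrow> ('a \<Rightarrow> 'b \<Rightarrow> 'b) \<Rightarrow> ('a \<Rightarrow> 'b \<Rightarrow> 'b) \<Rightarrow>
   ('b \<Rightarrow> 'a \<Rightarrow> 'a) \<Rightarrow> ('b \<Rightarrow> 'a \<Rightarrow> 'a) \<Rightarrow> 'a \<times> 'b \<Rightarrow> 'a \<times> 'b \<Rightarrow> 'a \<times> 'b"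
  where "bowtie_op op1 op2 l1 r1 l2 r2 = (\<lambda>(x, a) (y, b).
    (op1 x y + l2 a y + r2 b x, op2 a b + l1 x b + r1 y a))"

end

theory Submission
  imports Defs
begin

text \<open>
  Both operations on \<open>A\<^sub>1 \<oplus> A\<^sub>2\<close> are bilinear, because they are put together from bilinear maps, and
  \<open>A\<^sub>1 \<oplus> A\<^sub>2\<close> has finite dimension. Hence the direct sum is an anti-dendriform algebra if and only
  if the four identities of the definition hold in it.

  Each side of such an identity is additive in its three arguments, and every element is a sum
  \<open>(x, 0) + (0, a)\<close>. So an identity holds everywhere as soon as it holds on the eight kinds of
  triples whose entries lie in \<open>A\<^sub>1\<close> or \<open>A\<^sub>2\<close> (\<open>triadditive_eq_iff\<close>). On triples from one summand it is
  an axiom of that summand. Each of the six mixed kinds gives two equations, one for either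
  component of the result. The component in the summand that contributes only one entry contains
  no products of that summand: it is an equation between actions on that one entry, one of the
  conditions for a representation. The component in the other summand is one of the
  compatibility conditions between the products and the actions. The four identities thus give 48 equations
  (\<open>bowtie_succ_succ_iff\<close>, \<open>bowtie_succ_dot_iff\<close>, \<open>bowtie_prec_dot_iff\<close>,
  \<open>bowtie_succ_prec_iff\<close>): 12 for each of the two representations and 24 compatibility conditions. Every
  equation on the right-hand side arises exactly once, so no equation has to be solved or
  combined with another one; the proof is a matching of two lists.
\<close>

section \<open>Bilinear maps\<close>

lemma bilinear_map_simps:
  assumes "bilinear_map sU sV sW f"
  shows bilinear_map_add_left: "f (x + x') y = f x y + f x' y"
    and bilinear_map_add_right: "f x (y + y') = f x y + f x y'"
    and bilinear_map_zero_left: "f 0 y = 0"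
    and bilinear_map_zero_right: "f x 0 = 0"
proof -
  have R: "Vector_Spaces.linear sV sW (f x)" and L: "Vector_Spaces.linear sU sW (\<lambda>x. f x y)" for x y
    using assms by (auto simp: bilinear_map_def)
  show add: "f (x + x') y = f x y + f x' y" "f x (y + y') = f x y + f x y'" for x x' y y'
    using R L by (auto simp: Vector_Spaces.linear_iff)
  show "f 0 y = 0" and "f x 0 = 0"
    using add(1)[of 0 0] add(2)[of _ 0 0] by auto
qed

text \<open>
  Linearity into the endomorphisms is bilinearity of the action as a map of two arguments; in
  this form actions and products can be treated alike.
\<close>

lemma linear_into_End_imp_bilinear_map:
  assumes "linear_into_End sU sV l"
  shows "bilinear_map sU sV sV l"
  using assms unfolding linear_into_End_def bilinear_map_def Vector_Spaces.linear_iff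
  by (auto simp: fun_eq_iff)

lemma bilinear_map_bowtie_op:
  assumes op1: "bilinear_map s1 s1 s1 op1" and op2: "bilinear_map s2 s2 s2 op2"
    and l1: "bilinear_map s1 s2 s2 l1" and r1: "bilinear_map s1 s2 s2 r1"
    and l2: "bilinear_map s2 s1 s1 l2" and r2: "bilinear_map s2 s1 s1 r2"
  shows "bilinear_map (module_prod.scale s1 s2) (module_prod.scale s1 s2) (module_prod.scale s1 s2)
    (bowtie_op op1 op2 l1 r1 l2 r2)"
proof -
  have "vector_space s1" "vector_space s2"
    using op1 op2 by (auto simp: bilinear_map_def Vector_Spaces.linear_iff)
  then interpret vector_space_prod s1 s2
    by (simp add: vector_space_prod_def vector_space_pair_def)
  show ?thesis
    using assms unfolding bilinear_map_def Vector_Spaces.linear_iff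
    by (auto simp: bowtie_op_def scale_prod p.vector_space_axioms vs1.scale_right_distrib
      vs2.scale_right_distrib algebra_simps)
qed

section \<open>Identities between maps that are additive in three arguments\<close>

definition triadditive :: "('u::plus \<Rightarrow> 'u \<Rightarrow> 'u \<Rightarrow> 'w::plus) \<Rightarrow> bool"
  where "triadditive F \<longleftrightarrow>
    (\<forall>u u' v w. F (u + u') v w = F u v w + F u' v w) \<and>
    (\<forall>u v v' w. F u (v + v') w = F u v w + F u v' w) \<and>
    (\<forall>u v w w'. F u v (w + w') = F u v w + F u v w')"

text \<open>
  Splitting all three arguments as \<open>p = (fst p, 0) + (0, snd p)\<close> expands either side into the same
  sum of eight values at triples with entries in the summands.
\<close>

lemma triadditive_eq_iff:
  fixes F G :: "'a::monoid_add \<times> 'b::monoid_add \<Rightarrow> 'a \<times> 'b \<Rightarrow> 'a \<times> 'b \<Rightarrow> 'w::plus"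
  assumes F: "triadditive F" and G: "triadditive G"
  shows "(\<forall>u v w. F u v w = G u v w) \<longleftrightarrow>
    (\<forall>x y z. F (x, 0) (y, 0) (z, 0) = G (x, 0) (y, 0) (z, 0)) \<and>
    (\<forall>x y c. F (x, 0) (y, 0) (0, c) = G (x, 0) (y, 0) (0, c)) \<and>
    (\<forall>x b z. F (x, 0) (0, b) (z, 0) = G (x, 0) (0, b) (z, 0)) \<and>
    (\<forall>a y z. F (0, a) (y, 0) (z, 0) = G (0, a) (y, 0) (z, 0)) \<and>
    (\<forall>x b c. F (x, 0) (0, b) (0, c) = G (x, 0) (0, b) (0, c)) \<and>
    (\<forall>a y c. F (0, a) (y, 0) (0, c) = G (0, a) (y, 0) (0, c)) \<and>
    (\<forall>a b z. F (0, a) (0, b) (z, 0) = G (0, a) (0, b) (z, 0)) \<and>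
    (\<forall>a b c. F (0, a) (0, b) (0, c) = G (0, a) (0, b) (0, c))"
    (is "_ \<longleftrightarrow> ?pure")
proof
  assume pure: ?pure
  show "\<forall>u v w. F u v w = G u v w"
  proof (intro allI)
    fix u v w :: "'a \<times> 'b"
    have split: "p = (fst p, 0) + (0, snd p)" for p :: "'a \<times> 'b"
      by (simp add: prod_eq_iff)
    \<comment> \<open>The third argument is split outermost and the first one innermost: this bracketing
      is the one that rewriting with additivity yields.\<close>
    have expand: "H u v w =
        H (fst u, 0) (fst v, 0) (fst w, 0) + H (0, snd u) (fst v, 0) (fst w, 0) +
        (H (fst u, 0) (0, snd v) (fst w, 0) + H (0, snd u) (0, snd v) (fst w, 0)) +
        (H (fst u, 0) (fst v, 0) (0, snd w) + H (0, snd u) (fst v, 0) (0, snd w) +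
        (H (fst u, 0) (0, snd v) (0, snd w) + H (0, snd u) (0, snd v) (0, snd w)))"
      if "triadditive H" for H :: "'a \<times> 'b \<Rightarrow> 'a \<times> 'b \<Rightarrow> 'a \<times> 'b \<Rightarrow> 'w"
    proof -
      have "H u v w = H ((fst u, 0) + (0, snd u)) ((fst v, 0) + (0, snd v)) ((fst w, 0) + (0, snd w))"
        using split[of u] split[of v] split[of w] by simp
      then show ?thesis
        using that unfolding triadditive_def by (simp only:)
    qed
    show "F u v w = G u v w"
      unfolding expand[OF F] expand[OF G] using pure by simp
  qed
qed simp

section \<open>Representations in terms of elements\<close>

text \<open>
  As a destruction rule this matches quantified equations up to the order and the names of their
  three variables, which is how the lists of conditions differ from one another.
\<close>

lemma all3_D: "\<forall>x y z. P x y z \<Longrightarrow> P x y z"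
  by blast

text \<open>
  Evaluating the equations between operators at vectors brings them into the form in which they
  appear as components of products in the direct sum.
\<close>

lemma anti_dendriform_representation_iff:
  assumes "anti_dendriform_algebra sA succ prec" "vector_space sV"
    and "linear_into_End sA sV ls" "linear_into_End sA sV rs"
    and "linear_into_End sA sV lp" "linear_into_End sA sV rp"
  shows "anti_dendriform_representation sA succ prec sV ls rs lp rp \<longleftrightarrow>
    (\<forall>x y v.
      ls x (ls y v) = - ls (succ x y + prec x y) v \<and>
      - ls (succ x y + prec x y) v = - lp x (ls y v + lp y v) \<and>
      - lp x (ls y v + lp y v) = lp (prec x y) v \<and>
      rs (succ x y) v = - rs y (rs x v + rp x v) \<and>
      - rs y (rs x v + rp x v) = - rp (succ x y + prec x y) v \<and>
      - rp (succ x y + prec x y) v = rp y (rp x v) \<and>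
      ls x (rs y v) = - rs y (ls x v + lp x v) \<and>
      - rs y (ls x v + lp x v) = - lp x (rs y v + rp y v) \<and>
      - lp x (rs y v + rp y v) = rp y (lp x v) \<and>
      lp (succ x y) v = ls x (lp y v) \<and>
      rp y (rs x v) = rs (prec x y) v \<and>
      rp y (ls x v) = ls x (rp y v))"
  using assms
  unfolding anti_dendriform_representation_def anti_dendriform_representation_axioms_def
    fun_eq_iff
  by (simp only: o_apply plus_fun_apply uminus_apply simp_thms all_conj_distrib conj_assoc)
    (rule iffI; elim conjE; intro conjI allI; drule all3_D, assumption)

section \<open>The defining identities of the direct sum\<close>

text \<open>
  Two algebras with actions on each other that so far are only linear; the operations on the direct
  sum are then bilinear, but need not satisfy any identity.
\<close>

locale mutual_actions =
  A1: anti_dendriform_algebra scale1 succ1 prec1 + A2: anti_dendriform_algebra scale2 succ2 prec2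
  for scale1 :: "'k::field \<Rightarrow> 'a::ab_group_add \<Rightarrow> 'a"
    and succ1 :: "'a \<Rightarrow> 'a \<Rightarrow> 'a" (infixl "\<succ>\<^sub>1" 70)
    and prec1 :: "'a \<Rightarrow> 'a \<Rightarrow> 'a" (infixl "\<prec>\<^sub>1" 70)
    and scale2 :: "'k \<Rightarrow> 'b::ab_group_add \<Rightarrow> 'b"
    and succ2 :: "'b \<Rightarrow> 'b \<Rightarrow> 'b" (infixl "\<succ>\<^sub>2" 70)
    and prec2 :: "'b \<Rightarrow> 'b \<Rightarrow> 'b" (infixl "\<prec>\<^sub>2" 70) +
  fixes ls1 rs1 lp1 rp1 :: "'a \<Rightarrow> 'b \<Rightarrow> 'b"
    and ls2 rs2 lp2 rp2 :: "'b \<Rightarrow> 'a \<Rightarrow> 'a"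
  assumes linear_actions:
    "linear_into_End scale1 scale2 ls1" "linear_into_End scale1 scale2 rs1"
    "linear_into_End scale1 scale2 lp1" "linear_into_End scale1 scale2 rp1"
    "linear_into_End scale2 scale1 ls2" "linear_into_End scale2 scale1 rs2"
    "linear_into_End scale2 scale1 lp2" "linear_into_End scale2 scale1 rp2"
begin

abbreviation bowtie_succ (infixl "\<succ>" 70)
  where "bowtie_succ \<equiv> bowtie_op succ1 succ2 ls1 rs1 ls2 rs2"

abbreviation bowtie_prec (infixl "\<prec>" 70)
  where "bowtie_prec \<equiv> bowtie_op prec1 prec2 lp1 rp1 lp2 rp2"

abbreviation dot1 (infixl "\<cdot>\<^sub>1" 70) where "x \<cdot>\<^sub>1 y \<equiv> x \<succ>\<^sub>1 y + x \<prec>\<^sub>1 y"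
abbreviation dot2 (infixl "\<cdot>\<^sub>2" 70) where "a \<cdot>\<^sub>2 b \<equiv> a \<succ>\<^sub>2 b + a \<prec>\<^sub>2 b"

lemmas bilinear_actions = linear_actions[THEN linear_into_End_imp_bilinear_map]

lemmas bilinear_maps = A1.bilinear_succ A1.bilinear_prec A2.bilinear_succ A2.bilinear_prec
  bilinear_actions

lemmas zero_simps =
  bilinear_maps[THEN bilinear_map_zero_left] bilinear_maps[THEN bilinear_map_zero_right]

abbreviation "prod_scale \<equiv> module_prod.scale scale1 scale2"

lemma bilinear_bowtie_succ: "bilinear_map prod_scale prod_scale prod_scale bowtie_succ"
  and bilinear_bowtie_prec: "bilinear_map prod_scale prod_scale prod_scale bowtie_prec"
  by (intro bilinear_map_bowtie_op bilinear_maps)+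

lemma triadditive_bowtie:
  "triadditive (\<lambda>u v w. u \<succ> (v \<succ> w))"
  "triadditive (\<lambda>u v w. - ((u \<succ> v + u \<prec> v) \<succ> w))"
  "triadditive (\<lambda>u v w. - (u \<prec> (v \<succ> w + v \<prec> w)))"
  "triadditive (\<lambda>u v w. (u \<prec> v) \<prec> w)"
  "triadditive (\<lambda>u v w. (u \<succ> v) \<prec> w)"
  "triadditive (\<lambda>u v w. u \<succ> (v \<prec> w))"
  unfolding triadditive_def
  by (simp_all add: bilinear_map_simps(1,2)[OF bilinear_bowtie_succ]
    bilinear_map_simps(1,2)[OF bilinear_bowtie_prec])

lemma vector_space_prod_scale: "vector_space prod_scale"
  using bilinear_bowtie_succ by (simp add: bilinear_map_def Vector_Spaces.linear_iff)

lemma finite_dim_prod_scale: "\<exists>Basis. finite_dimensional_vector_space prod_scale Basis"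
proof -
  obtain B1 B2 where "finite_dimensional_vector_space scale1 B1"
    and "finite_dimensional_vector_space scale2 B2"
    using A1.finite_dim A2.finite_dim by blast
  then interpret finite_dimensional_vector_space_prod scale1 scale2 B1 B2
    by (simp add: finite_dimensional_vector_space_prod_def vector_space_prod_def
      vector_space_pair_def finite_dimensional_vector_space_pair_def
      finite_dimensional_vector_space_pair_1_def A1.vector_space_axioms A2.vector_space_axioms)
  show ?thesis
    using p.finite_dimensional_vector_space_axioms by blast
qed

lemma anti_dendriform_bowtie_iff:
  "anti_dendriform_algebra prod_scale bowtie_succ bowtie_prec \<longleftrightarrow>
    (\<forall>u v w. u \<succ> (v \<succ> w) = - ((u \<succ> v + u \<prec> v) \<succ> w)) \<and>
    (\<forall>u v w. - ((u \<succ> v + u \<prec> v) \<succ> w) = - (u \<prec> (v \<succ> w + v \<prec> w))) \<and>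
    (\<forall>u v w. - (u \<prec> (v \<succ> w + v \<prec> w)) = (u \<prec> v) \<prec> w) \<and>
    (\<forall>u v w. (u \<succ> v) \<prec> w = u \<succ> (v \<prec> w))"
  by (simp only: anti_dendriform_algebra_def anti_dendriform_algebra_axioms_def vector_space_prod_scale
    finite_dim_prod_scale bilinear_bowtie_succ bilinear_bowtie_prec simp_thms conj_assoc)

lemmas pure_triple_simps = bowtie_op_def zero_simps

text \<open>
  In the next four lemmas, one for each defining identity, the six conjuncts belong to the mixed
  kinds of triples, and the two equations in each of them are the components in the first and in
  the second summand. For the triple \<open>(x, 0)\<close>, \<open>(y, 0)\<close>, \<open>(0, c)\<close>, for example, the second equation
  concerns the action of the first algebra on \<open>c\<close> alone, and the first one mixes products of the
  first algebra with actions of \<open>c\<close>. The remaining two kinds of triples give axioms of the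
  summands and leave no condition.
\<close>

lemma bowtie_succ_succ_iff:
  "(\<forall>u v w. u \<succ> (v \<succ> w) = - ((u \<succ> v + u \<prec> v) \<succ> w)) \<longleftrightarrow>
    (\<forall>x y c.
      x \<succ>\<^sub>1 (rs2 c y) + rs2 (ls1 y c) x = - rs2 c (x \<cdot>\<^sub>1 y) \<and>
      ls1 x (ls1 y c) = - ls1 (x \<cdot>\<^sub>1 y) c) \<and>
    (\<forall>x b z.
      x \<succ>\<^sub>1 (ls2 b z) + rs2 (rs1 z b) x = - ((rs2 b x + rp2 b x) \<succ>\<^sub>1 z) - ls2 (ls1 x b + lp1 x b) z \<and>
      ls1 x (rs1 z b) = - rs1 z (ls1 x b + lp1 x b)) \<and>
    (\<forall>a y z.
      ls2 a (y \<succ>\<^sub>1 z) = - ((ls2 a y + lp2 a y) \<succ>\<^sub>1 z) - ls2 (rs1 y a + rp1 y a) z \<and>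
      rs1 (y \<succ>\<^sub>1 z) a = - rs1 z (rs1 y a + rp1 y a)) \<and>
    (\<forall>x b c.
      rs2 (b \<succ>\<^sub>2 c) x = - rs2 c (rs2 b x + rp2 b x) \<and>
      ls1 x (b \<succ>\<^sub>2 c) = - ((ls1 x b + lp1 x b) \<succ>\<^sub>2 c) - ls1 (rs2 b x + rp2 b x) c) \<and>
    (\<forall>a y c.
      ls2 a (rs2 c y) = - rs2 c (ls2 a y + lp2 a y) \<and>
      a \<succ>\<^sub>2 (ls1 y c) + rs1 (rs2 c y) a = - ((rs1 y a + rp1 y a) \<succ>\<^sub>2 c) - ls1 (ls2 a y + lp2 a y) c) \<and>
    (\<forall>a b z.
      ls2 a (ls2 b z) = - ls2 (a \<cdot>\<^sub>2 b) z \<and>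
      a \<succ>\<^sub>2 (rs1 z b) + rs1 (ls2 b z) a = - rs1 z (a \<cdot>\<^sub>2 b))"
  unfolding triadditive_eq_iff[OF triadditive_bowtie(1,2)]
  by (simp add: pure_triple_simps A1.succ_succ A2.succ_succ)

lemma bowtie_succ_dot_iff:
  "(\<forall>u v w. - ((u \<succ> v + u \<prec> v) \<succ> w) = - (u \<prec> (v \<succ> w + v \<prec> w))) \<longleftrightarrow>
    (\<forall>x y c.
      - rs2 c (x \<cdot>\<^sub>1 y) = - (x \<prec>\<^sub>1 (rs2 c y + rp2 c y)) - rp2 (ls1 y c + lp1 y c) x \<and>
      - ls1 (x \<cdot>\<^sub>1 y) c = - lp1 x (ls1 y c + lp1 y c)) \<and>
    (\<forall>x b z.
      - ((rs2 b x + rp2 b x) \<succ>\<^sub>1 z) - ls2 (ls1 x b + lp1 x b) z = - (x \<prec>\<^sub>1 (ls2 b z + lp2 b z)) - rp2 (rs1 z b + rp1 z b) x \<and>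
      - rs1 z (ls1 x b + lp1 x b) = - lp1 x (rs1 z b + rp1 z b)) \<and>
    (\<forall>a y z.
      - ((ls2 a y + lp2 a y) \<succ>\<^sub>1 z) - ls2 (rs1 y a + rp1 y a) z = - lp2 a (y \<cdot>\<^sub>1 z) \<and>
      - rs1 z (rs1 y a + rp1 y a) = - rp1 (y \<cdot>\<^sub>1 z) a) \<and>
    (\<forall>x b c.
      - rs2 c (rs2 b x + rp2 b x) = - rp2 (b \<cdot>\<^sub>2 c) x \<and>
      - ((ls1 x b + lp1 x b) \<succ>\<^sub>2 c) - ls1 (rs2 b x + rp2 b x) c = - lp1 x (b \<cdot>\<^sub>2 c)) \<and>
    (\<forall>a y c.
      - rs2 c (ls2 a y + lp2 a y) = - lp2 a (rs2 c y + rp2 c y) \<and>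
      - ((rs1 y a + rp1 y a) \<succ>\<^sub>2 c) - ls1 (ls2 a y + lp2 a y) c = - (a \<prec>\<^sub>2 (ls1 y c + lp1 y c)) - rp1 (rs2 c y + rp2 c y) a) \<and>
    (\<forall>a b z.
      - ls2 (a \<cdot>\<^sub>2 b) z = - lp2 a (ls2 b z + lp2 b z) \<and>
      - rs1 z (a \<cdot>\<^sub>2 b) = - (a \<prec>\<^sub>2 (rs1 z b + rp1 z b)) - rp1 (ls2 b z + lp2 b z) a)"
  unfolding triadditive_eq_iff[OF triadditive_bowtie(2,3)]
  by (simp add: pure_triple_simps A1.succ_dot A2.succ_dot)

lemma bowtie_prec_dot_iff:
  "(\<forall>u v w. - (u \<prec> (v \<succ> w + v \<prec> w)) = (u \<prec> v) \<prec> w) \<longleftrightarrow>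
    (\<forall>x y c.
      - (x \<prec>\<^sub>1 (rs2 c y + rp2 c y)) - rp2 (ls1 y c + lp1 y c) x = rp2 c (x \<prec>\<^sub>1 y) \<and>
      - lp1 x (ls1 y c + lp1 y c) = lp1 (x \<prec>\<^sub>1 y) c) \<and>
    (\<forall>x b z.
      - (x \<prec>\<^sub>1 (ls2 b z + lp2 b z)) - rp2 (rs1 z b + rp1 z b) x = (rp2 b x) \<prec>\<^sub>1 z + lp2 (lp1 x b) z \<and>
      - lp1 x (rs1 z b + rp1 z b) = rp1 z (lp1 x b)) \<and>
    (\<forall>a y z.
      - lp2 a (y \<cdot>\<^sub>1 z) = (lp2 a y) \<prec>\<^sub>1 z + lp2 (rp1 y a) z \<and>
      - rp1 (y \<cdot>\<^sub>1 z) a = rp1 z (rp1 y a)) \<and>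
    (\<forall>x b c.
      - rp2 (b \<cdot>\<^sub>2 c) x = rp2 c (rp2 b x) \<and>
      - lp1 x (b \<cdot>\<^sub>2 c) = (lp1 x b) \<prec>\<^sub>2 c + lp1 (rp2 b x) c) \<and>
    (\<forall>a y c.
      - lp2 a (rs2 c y + rp2 c y) = rp2 c (lp2 a y) \<and>
      - (a \<prec>\<^sub>2 (ls1 y c + lp1 y c)) - rp1 (rs2 c y + rp2 c y) a = (rp1 y a) \<prec>\<^sub>2 c + lp1 (lp2 a y) c) \<and>
    (\<forall>a b z.
      - lp2 a (ls2 b z + lp2 b z) = lp2 (a \<prec>\<^sub>2 b) z \<and>
      - (a \<prec>\<^sub>2 (rs1 z b + rp1 z b)) - rp1 (ls2 b z + lp2 b z) a = rp1 z (a \<prec>\<^sub>2 b))"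
  unfolding triadditive_eq_iff[OF triadditive_bowtie(3,4)]
  by (simp add: pure_triple_simps A1.prec_dot A2.prec_dot)

lemma bowtie_succ_prec_iff:
  "(\<forall>u v w. (u \<succ> v) \<prec> w = u \<succ> (v \<prec> w)) \<longleftrightarrow>
    (\<forall>x y c.
      rp2 c (x \<succ>\<^sub>1 y) = x \<succ>\<^sub>1 (rp2 c y) + rs2 (lp1 y c) x \<and>
      lp1 (x \<succ>\<^sub>1 y) c = ls1 x (lp1 y c)) \<and>
    (\<forall>x b z.
      (rs2 b x) \<prec>\<^sub>1 z + lp2 (ls1 x b) z = x \<succ>\<^sub>1 (lp2 b z) + rs2 (rp1 z b) x \<and>
      rp1 z (ls1 x b) = ls1 x (rp1 z b)) \<and>
    (\<forall>a y z.
      (ls2 a y) \<prec>\<^sub>1 z + lp2 (rs1 y a) z = ls2 a (y \<prec>\<^sub>1 z) \<and>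
      rp1 z (rs1 y a) = rs1 (y \<prec>\<^sub>1 z) a) \<and>
    (\<forall>x b c.
      rp2 c (rs2 b x) = rs2 (b \<prec>\<^sub>2 c) x \<and>
      (ls1 x b) \<prec>\<^sub>2 c + lp1 (rs2 b x) c = ls1 x (b \<prec>\<^sub>2 c)) \<and>
    (\<forall>a y c.
      rp2 c (ls2 a y) = ls2 a (rp2 c y) \<and>
      (rs1 y a) \<prec>\<^sub>2 c + lp1 (ls2 a y) c = a \<succ>\<^sub>2 (lp1 y c) + rs1 (rp2 c y) a) \<and>
    (\<forall>a b z.
      lp2 (a \<succ>\<^sub>2 b) z = ls2 a (lp2 b z) \<and>
      rp1 z (a \<succ>\<^sub>2 b) = a \<succ>\<^sub>2 (rp1 z b) + rs1 (lp2 b z) a)"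
  unfolding triadditive_eq_iff[OF triadditive_bowtie(5,6)]
  by (simp add: pure_triple_simps A1.succ_prec A2.succ_prec)

end

section \<open>The characterization\<close>

theorem proposition5p1:
  fixes scale1 :: "'k::field \<Rightarrow> 'a::ab_group_add \<Rightarrow> 'a"
    and scale2 :: "'k \<Rightarrow> 'b::ab_group_add \<Rightarrow> 'b"
    and succ1 :: "'a \<Rightarrow> 'a \<Rightarrow> 'a" (infixl "\<succ>\<^sub>1" 70)
    and prec1 :: "'a \<Rightarrow> 'a \<Rightarrow> 'a" (infixl "\<prec>\<^sub>1" 70)
    and succ2 :: "'b \<Rightarrow> 'b \<Rightarrow> 'b" (infixl "\<succ>\<^sub>2" 70)
    and prec2 :: "'b \<Rightarrow> 'b \<Rightarrow> 'b" (infixl "\<prec>\<^sub>2" 70)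
    and ls1 rs1 lp1 rp1 :: "'a \<Rightarrow> 'b \<Rightarrow> 'b"
    and ls2 rs2 lp2 rp2 :: "'b \<Rightarrow> 'a \<Rightarrow> 'a"
  assumes "anti_dendriform_algebra scale1 succ1 prec1"
    and "anti_dendriform_algebra scale2 succ2 prec2"
    and "linear_into_End scale1 scale2 ls1" and "linear_into_End scale1 scale2 rs1"
    and "linear_into_End scale1 scale2 lp1" and "linear_into_End scale1 scale2 rp1"
    and "linear_into_End scale2 scale1 ls2" and "linear_into_End scale2 scale1 rs2"
    and "linear_into_End scale2 scale1 lp2" and "linear_into_End scale2 scale1 rp2"
  shows "anti_dendriform_algebra (module_prod.scale scale1 scale2)
           (bowtie_op succ1 succ2 ls1 rs1 ls2 rs2) (bowtie_op prec1 prec2 lp1 rp1 lp2 rp2) \<longleftrightarrow>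
      anti_dendriform_representation scale1 succ1 prec1 scale2 ls1 rs1 lp1 rp1 \<and>
      anti_dendriform_representation scale2 succ2 prec2 scale1 ls2 rs2 lp2 rp2 \<and>
      (\<forall>x y z a b c.
         (x \<succ>\<^sub>1 (rs2 c y) + rs2 (ls1 y c) x = - rs2 c (x \<succ>\<^sub>1 y + x \<prec>\<^sub>1 y)) \<and>
         (- rs2 c (x \<succ>\<^sub>1 y + x \<prec>\<^sub>1 y) = - (x \<prec>\<^sub>1 ((rs2 + rp2) c y)) - rp2 ((ls1 + lp1) y c) x) \<and>
         (- (x \<prec>\<^sub>1 ((rs2 + rp2) c y)) - rp2 ((ls1 + lp1) y c) x = rp2 c (x \<prec>\<^sub>1 y)) \<and>

         (x \<succ>\<^sub>1 (ls2 b z) + rs2 (rs1 z b) x = - (((rs2 + rp2) b x) \<succ>\<^sub>1 z) - ls2 ((ls1 + lp1) x b) z) \<and>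
         (- (((rs2 + rp2) b x) \<succ>\<^sub>1 z) - ls2 ((ls1 + lp1) x b) z = - (x \<prec>\<^sub>1 ((ls2 + lp2) b z)) - rp2 ((rs1 + rp1) z b) x) \<and>
         (- (x \<prec>\<^sub>1 ((ls2 + lp2) b z)) - rp2 ((rs1 + rp1) z b) x = (rp2 b x) \<prec>\<^sub>1 z + lp2 (lp1 x b) z) \<and>

         (ls2 a (y \<succ>\<^sub>1 z) = - (((ls2 + lp2) a y) \<succ>\<^sub>1 z) - ls2 ((rs1 + rp1) y a) z) \<and>
         (- (((ls2 + lp2) a y) \<succ>\<^sub>1 z) - ls2 ((rs1 + rp1) y a) z = - lp2 a (y \<succ>\<^sub>1 z + y \<prec>\<^sub>1 z)) \<and>
         (- lp2 a (y \<succ>\<^sub>1 z + y \<prec>\<^sub>1 z) = (lp2 a y) \<prec>\<^sub>1 z + lp2 (rp1 y a) z) \<and>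

         (ls1 x (b \<succ>\<^sub>2 c) = - (((ls1 + lp1) x b) \<succ>\<^sub>2 c) - ls1 ((rs2 + rp2) b x) c) \<and>
         (- (((ls1 + lp1) x b) \<succ>\<^sub>2 c) - ls1 ((rs2 + rp2) b x) c = - lp1 x (b \<succ>\<^sub>2 c + b \<prec>\<^sub>2 c)) \<and>
         (- lp1 x (b \<succ>\<^sub>2 c + b \<prec>\<^sub>2 c) = (lp1 x b) \<prec>\<^sub>2 c + lp1 (rp2 b x) c) \<and>

         (a \<succ>\<^sub>2 (ls1 y c) + rs1 (rs2 c y) a = - (((rs1 + rp1) y a) \<succ>\<^sub>2 c) - ls1 ((ls2 + lp2) a y) c) \<and>
         (- (((rs1 + rp1) y a) \<succ>\<^sub>2 c) - ls1 ((ls2 + lp2) a y) c = - (a \<prec>\<^sub>2 ((ls1 + lp1) y c)) - rp1 ((rs2 + rp2) c y) a) \<and>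
         (- (a \<prec>\<^sub>2 ((ls1 + lp1) y c)) - rp1 ((rs2 + rp2) c y) a = (rp1 y a) \<prec>\<^sub>2 c + lp1 (lp2 a y) c) \<and>

         (a \<succ>\<^sub>2 (rs1 z b) + rs1 (ls2 b z) a = - rs1 z (a \<succ>\<^sub>2 b + a \<prec>\<^sub>2 b)) \<and>
         (- rs1 z (a \<succ>\<^sub>2 b + a \<prec>\<^sub>2 b) = - (a \<prec>\<^sub>2 ((rs1 + rp1) z b)) - rp1 ((ls2 + lp2) b z) a) \<and>
         (- (a \<prec>\<^sub>2 ((rs1 + rp1) z b)) - rp1 ((ls2 + lp2) b z) a = rp1 z (a \<prec>\<^sub>2 b)) \<and>

         (rp2 c (x \<succ>\<^sub>1 y) = x \<succ>\<^sub>1 (rp2 c y) + rs2 (lp1 y c) x) \<and>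

         ((rs2 b x) \<prec>\<^sub>1 z + lp2 (ls1 x b) z = x \<succ>\<^sub>1 (lp2 b z) + rs2 (rp1 z b) x) \<and>

         ((ls2 a y) \<prec>\<^sub>1 z + lp2 (rs1 y a) z = ls2 a (y \<prec>\<^sub>1 z)) \<and>

         ((ls1 x b) \<prec>\<^sub>2 c + lp1 (rs2 b x) c = ls1 x (b \<prec>\<^sub>2 c)) \<and>

         ((rs1 y a) \<prec>\<^sub>2 c + lp1 (ls2 a y) c = a \<succ>\<^sub>2 (lp1 y c) + rs1 (rp2 c y) a) \<and>

         (rp1 z (a \<succ>\<^sub>2 b) = a \<succ>\<^sub>2 (rp1 z b) + rs1 (lp2 b z) a))"
proof -
  interpret mutual_actions scale1 succ1 prec1 scale2 succ2 prec2 ls1 rs1 lp1 rp1 ls2 rs2 lp2 rp2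
    using assms by (simp add: mutual_actions_def mutual_actions_axioms_def)
  \<comment> \<open>Written as single equations, both sides become the same 48 conditions, in different orders.\<close>
  show ?thesis
    unfolding anti_dendriform_bowtie_iff bowtie_succ_succ_iff bowtie_succ_dot_iff
      bowtie_prec_dot_iff bowtie_succ_prec_iff
      anti_dendriform_representation_iff[OF A1.anti_dendriform_algebra_axioms
        A2.vector_space_axioms linear_actions(1-4)]
      anti_dendriform_representation_iff[OF A2.anti_dendriform_algebra_axioms
        A1.vector_space_axioms linear_actions(5-8)]
      plus_fun_apply all_conj_distrib simp_thms
    by (rule iffI; elim conjE; intro conjI allI; drule all3_D, assumption)
qed

end
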